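(* Let $c$ be a real or complex number, $\underline{c}=(c,c,c,\dots)$, and $k\ge0$ an integer. Let $A(x,c)=\sum_{n\ge0}a_{n,0}(\underline{c})x^n$ and define $b_{n,k}(\underline{c})$ by $\frac{1}{A(x,c)^{k+1}}=\sum_{n\ge0}b_{n,k}(\underline{c})x^n$ (as formal power series). Then for every integer $n\ge0$, $$d_{0,k,n+1}(\underline{c}):=\det\left(b_{i+j,k}(\underline{c})\right)_{i,j=0}^{n}=(-1)^n D_{k+2,k,n}(\underline{c}).$$
   Context: For a sequence $\mathbf{s}=(s_k)_{k\ge0}$ define numbers $a_{n,k}(\mathbf{s})$ for $n\ge 0$, $k\in\mathbb{Z}$ by $a_{0,k}(\mathbf{s})=[k=0]$ (i.e. $1$ if $k=0$, else $0$), $a_{n,k}(\mathbf{s})=0$ for $k<0$, and for $n\ge1$, $k\ge 0$: $a_{n,k}(\mathbf{s})=a_{n-1,k-1}(\mathbf{s})+s_k\,a_{n-1,k}(\mathbf{s})+a_{n-1,k+1}(\mathbf{s})$. For integers $m$, $k\ge0$, $n\ge 0$ define $D_{m,k,n}(\mathbf{s})=\det\left(a_{i+j+m,k}(\mathbf{s})\right)_{i,j=0}^{n-1}$, with $D_{m,k,0}(\mathbf{s})=1$. Since $a_{0,0}(\underline{c})=1$, $A(x,c)$ is an invertible formal power series. *)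

theory Defs
  imports
    Complex_Main
    "Jordan_Normal_Form.Determinant"
    "HOL-Computational_Algebra.Formal_Power_Series"
begin

text \<open>The lower index ranges over all integers: the value at index \<open>-1\<close> occurs in the recursion at index \<open>0\<close>.\<close>

primrec a_num :: "(nat \<Rightarrow> 'a::comm_ring_1) \<Rightarrow> nat \<Rightarrow> int \<Rightarrow> 'a" where
  "a_num s 0 k = (if k = 0 then 1 else 0)"
| "a_num s (Suc n) k =
     (if k < 0 then 0
      else a_num s n (k - 1) + s (nat k) * a_num s n k + a_num s n (k + 1))"

text \<open>The determinant of a \<open>0 \<times> 0\<close> matrix is \<open>1\<close> in the library, so no separate
  clause is needed for size \<open>0\<close>; see \<open>hankel_D_0\<close>.\<close>

definition hankel_D :: "nat \<Rightarrow> nat \<Rightarrow> nat \<Rightarrow> (nat \<Rightarrow> 'a::comm_ring_1) \<Rightarrow> 'a" where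
  "hankel_D m k n s = det (mat n n (\<lambda>(i, j). a_num s (i + j + m) (int k)))"

lemma hankel_D_0: "hankel_D m k 0 s = 1"
  by (simp add: hankel_D_def)

definition A_fps :: "'a::field \<Rightarrow> 'a fps" where
  "A_fps c = Abs_fps (\<lambda>n. a_num (\<lambda>_. c) n 0)"

text \<open>Division below is division by a unit of the power series ring, as the constant
  coefficient of \<open>A_fps c\<close> is \<open>1\<close>.\<close>

lemma fps_nth_A_fps_0: "fps_nth (A_fps c) 0 = 1"
  by (simp add: A_fps_def)

definition b_num :: "'a::field \<Rightarrow> nat \<Rightarrow> nat \<Rightarrow> 'a" where
  "b_num c n k = fps_nth (1 / A_fps c ^ (k + 1)) n"

definition hankel_d :: "nat \<Rightarrow> nat \<Rightarrow> nat \<Rightarrow> 'a::field \<Rightarrow> 'a" where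
  "hankel_d m k n c = det (mat n n (\<lambda>(i, j). b_num c (i + j + m) k))"

end

theory Submission
  imports Defs
begin

unbundle fps_syntax
no_notation vec_index (infixl "$" 100)

text \<open>
  The generating function of \<open>a\<^bsub>n,k\<^esub>\<close> is \<open>x\<^sup>k A\<^sup>k\<^sup>+\<^sup>1\<close>, so both determinants are Hankel determinants of
  a power series \<open>G = A\<^sup>k\<^sup>+\<^sup>1\<close> and of its inverse \<open>B\<close>. Multiplying the Hankel matrix of \<open>B\<close> on the
  left by the unitriangular Toeplitz matrix of \<open>G\<close> and on the right by its transpose turns its bivariate generating function
  \<open>(x B(x) - y B(y)) / (x - y)\<close> into \<open>(x G(y) - y G(x)) / (x - y)\<close>, whose coefficient matrix is block
  diagonal with blocks \<open>1\<close> and \<open>-(g\<^bsub>i+j\<^esub>)\<close>, \<open>i, j \<ge> 1\<close>.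
\<close>

definition a_fps :: "'a::comm_ring_1 \<Rightarrow> nat \<Rightarrow> 'a fps" where
  "a_fps c k = Abs_fps (\<lambda>n. a_num (\<lambda>_. c) n (int k))"

lemma a_num_neg: "k < 0 \<Longrightarrow> a_num s n k = 0"
  by (cases n) auto

lemma a_fps_0: "a_fps c 0 = 1 + fps_X * (fps_const c * a_fps c 0 + a_fps c 1)"
proof (rule fps_ext)
  fix n
  show "a_fps c 0 $ n = (1 + fps_X * (fps_const c * a_fps c 0 + a_fps c 1)) $ n"
    by (cases n) (simp_all add: a_fps_def a_num_neg)
qed

lemma a_fps_Suc:
  "a_fps c (Suc k) = fps_X * (a_fps c k + fps_const c * a_fps c (Suc k) + a_fps c (Suc (Suc k)))"
proof (rule fps_ext)
  fix n
  show "a_fps c (Suc k) $ n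
      = (fps_X * (a_fps c k + fps_const c * a_fps c (Suc k) + a_fps c (Suc (Suc k)))) $ n"
    by (cases n) (simp_all add: a_fps_def algebra_simps)
qed

text \<open>The differences of the two sides satisfy the recursion without its initial term, so they
  vanish.\<close>

lemma a_fps_Suc_eq_mult: "a_fps c (Suc k) = fps_X * a_fps c k * a_fps c 0"
proof -
  define E where "E k = a_fps c (Suc k) - fps_X * a_fps c k * a_fps c 0" for k
  have E_0: "E 0 = fps_X * (fps_const c * E 0 + E 1)"
  proof -
    have "E 0 = a_fps c (Suc 0) - fps_X * a_fps c 0 * a_fps c 0"
      by (simp add: E_def)
    \<comment> \<open>Only the left factor of the product is expanded. The right factor
      \<open>a_fps c 0\<close> stays, so that the terms regroup into \<open>E 0\<close> and
      \<open>E 1\<close>; the initial term 1 cancels the summand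
      \<open>fps_X * a_fps c 0\<close>.\<close>
    also have "\<dots> = fps_X * (a_fps c 0 + fps_const c * a_fps c 1 + a_fps c 2)
        - fps_X * (1 + fps_X * (fps_const c * a_fps c 0 + a_fps c 1)) * a_fps c 0"
      using a_fps_0[of c] a_fps_Suc[of c 0] by (simp add: numeral_2_eq_2)
    also have "\<dots> = fps_X * (fps_const c * E 0 + E 1)"
      by (simp add: E_def algebra_simps numeral_2_eq_2)
    finally show ?thesis .
  qed
  have E_Suc: "E (Suc k) = fps_X * (E k + fps_const c * E (Suc k) + E (Suc (Suc k)))" for k
  proof -
    have "E (Suc k) = a_fps c (Suc (Suc k)) - fps_X * a_fps c (Suc k) * a_fps c 0"
      by (simp add: E_def)
    also have "\<dots> = fps_X * (a_fps c (Suc k) + fps_const c * a_fps c (Suc (Suc k)) + a_fps c (Suc (Suc (Suc k))))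
        - fps_X * (fps_X * (a_fps c k + fps_const c * a_fps c (Suc k) + a_fps c (Suc (Suc k)))) * a_fps c 0"
      using a_fps_Suc[of c k] a_fps_Suc[of c "Suc k"] by simp
    also have "\<dots> = fps_X * (E k + fps_const c * E (Suc k) + E (Suc (Suc k)))"
      by (simp add: E_def algebra_simps)
    finally show ?thesis .
  qed
  \<comment> \<open>Both recursions carry a factor \<open>fps_X\<close>, so coefficient
    \<open>Suc n\<close> depends only on coefficients of index \<open>n\<close>, at neighbouring
    \<open>k\<close>; hence \<open>k\<close> is arbitrary in the induction.\<close>
  have "E k $ n = 0" for n k
  proof (induction n arbitrary: k)
    case 0
    show ?case
    proof (cases k)
      case 0
      then show ?thesis by (subst 0, subst E_0) simp
    next
      case (Suc l)
      then show ?thesis by (subst Suc, subst E_Suc) simp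
    qed
  next
    case (Suc n)
    show ?case
    proof (cases k)
      case 0
      then show ?thesis using Suc by (subst 0, subst E_0) simp
    next
      case (Suc l)
      then show ?thesis using Suc.IH by (subst Suc, subst E_Suc) simp
    qed
  qed
  then have "E k = 0" by (simp add: fps_ext)
  then show ?thesis by (simp add: E_def)
qed

lemma a_fps_eq_power: "a_fps c k = fps_X ^ k * a_fps c 0 ^ Suc k"
  by (induction k) (simp_all add: a_fps_Suc_eq_mult[of c] mult_ac)

text \<open>The sum is the generating function of row \<open>i\<close> of Toeplitz times Hankel; the
  factor \<open>G\<close> accounts for the transposed Toeplitz matrix on the right. Each row is the
  shift of the previous one plus a multiple of \<open>inverse G\<close>, which permits induction on
  \<open>i\<close>.\<close>

lemma toeplitz_mult_hankel_inverse:
  fixes G :: "'a::field fps"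
  assumes "G $ 0 = 1"
  shows "(\<Sum>p\<le>i. fps_const (G $ (i - p)) * fps_shift p (inverse G)) * G
    = (if i = 0 then 1 else fps_const (G $ i) - fps_shift i G)"
proof -
  define B where "B = inverse G"
  have BG: "B * G = 1"
    using assms by (simp add: B_def inverse_mult_eq_1)
  then have B_0: "B $ 0 = 1"
    using assms by (metis fps_mult_nth_0 fps_one_nth mult.right_neutral)
  define S where "S i = (\<Sum>p\<le>i. fps_const (G $ (i - p)) * fps_shift p B)" for i
  have S_Suc: "S (Suc i) = fps_const (G $ Suc i) * B + fps_shift 1 (S i)" for i
  proof -
    have "S (Suc i) = fps_const (G $ Suc i) * B
        + (\<Sum>p\<le>i. fps_const (G $ (i - p)) * fps_shift (Suc p) B)"
      unfolding S_def by (subst sum.atMost_Suc_shift) simp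
    also have "(\<Sum>p\<le>i. fps_const (G $ (i - p)) * fps_shift (Suc p) B) = fps_shift 1 (S i)"
      unfolding S_def by (rule fps_ext) (simp add: fps_sum_nth)
    finally show ?thesis .
  qed
  \<comment> \<open>The constant coefficient is a convolution of \<open>B\<close> and
    \<open>G\<close>, so the correction term of the shift survives only at
    \<open>i = 0\<close>.\<close>
  have S_nth_0: "S i $ 0 = (if i = 0 then 1 else 0)" for i
  proof -
    have "S i $ 0 = (B * G) $ i"
      by (simp add: S_def fps_sum_nth fps_mult_nth mult.commute atLeast0AtMost)
    then show ?thesis by (simp add: BG)
  qed
  have X_shift: "fps_X * fps_shift 1 F = F - fps_const (F $ 0)" for F :: "'a fps"
    by (rule fps_ext) (simp add: fps_X_mult_nth)
  have "S i * G = (if i = 0 then 1 else fps_const (G $ i) - fps_shift i G)"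
  proof (induction i)
    case 0
    show ?case using assms by (simp add: S_def BG)
  next
    case (Suc i)
    have "fps_X * (S (Suc i) * G)
        = fps_X * fps_const (G $ Suc i) * (B * G) + (fps_X * fps_shift 1 (S i)) * G"
      by (simp add: S_Suc algebra_simps)
    also have "\<dots> = fps_X * fps_const (G $ Suc i) + S i * G - fps_const (S i $ 0) * G"
      by (simp only: X_shift BG) (simp add: algebra_simps)
    \<comment> \<open>The case \<open>i = 0\<close> fits the general form: there
      \<open>S i * G - G\<close> is \<open>1 - G\<close>, and \<open>G $ 0 = 1\<close>.\<close>
    also have "\<dots> = fps_X * fps_const (G $ Suc i) - (fps_shift i G - fps_const (G $ i))"
      using assms by (simp add: Suc S_nth_0)
    also have "fps_shift i G - fps_const (G $ i) = fps_X * fps_shift (Suc i) G"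
      using X_shift[of "fps_shift i G"] by (simp add: fps_shift_fps_shift[symmetric])
    finally have "fps_X * (S (Suc i) * G)
        = fps_X * (fps_const (G $ Suc i) - fps_shift (Suc i) G)"
      by (simp add: algebra_simps)
    then have "S (Suc i) * G = fps_const (G $ Suc i) - fps_shift (Suc i) G"
      by simp
    then show ?case by simp
  qed
  then show ?thesis by (simp add: S_def B_def)
qed

lemma det_hankel_inverse:
  fixes G :: "'a::field fps"
  assumes G_0: "G $ 0 = 1"
  shows "det (mat (Suc n) (Suc n) (\<lambda>(i, j). inverse G $ (i + j)))
    = (-1) ^ n * det (mat n n (\<lambda>(i, j). G $ (i + j + 2)))"
proof -
  define B where "B = inverse G"
  define H where "H = mat (Suc n) (Suc n) (\<lambda>(i, j). B $ (i + j))"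
  define T where "T = mat (Suc n) (Suc n) (\<lambda>(i, j). if j \<le> i then G $ (i - j) else 0)"
  define K where "K = mat n n (\<lambda>(i, j). G $ (i + j + 2))"
  have carrier: "H \<in> carrier_mat (Suc n) (Suc n)" "T \<in> carrier_mat (Suc n) (Suc n)"
      "K \<in> carrier_mat n n"
    by (simp_all add: H_def T_def K_def)
  have "det T = prod_list (diag_mat T)"
    by (rule det_lower_triangular[OF _ carrier(2)]) (simp add: T_def)
  also have "diag_mat T = replicate (Suc n) 1"
    by (rule nth_equalityI) (simp_all add: diag_mat_def T_def G_0 del: upt_Suc replicate_Suc)
  finally have det_T: "det T = 1" by simp
  define P where "P = T * H"
  have P_carrier: "P \<in> carrier_mat (Suc n) (Suc n)"
    using carrier by (simp add: P_def)
  have TH: "P $$ (i, q) = (\<Sum>p\<le>i. fps_const (G $ (i - p)) * fps_shift p B) $ q"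
    if "i < Suc n" "q < Suc n" for i q
  proof -
    have "P $$ (i, q) = (\<Sum>p<Suc n. (if p \<le> i then G $ (i - p) else 0) * B $ (p + q))"
      using that by (simp add: P_def T_def H_def scalar_prod_def lessThan_atLeast0 del: sum.op_ivl_Suc)
    also have "\<dots> = (\<Sum>p\<le>i. G $ (i - p) * B $ (p + q))"
      using that by (intro sum.mono_neutral_cong_right) auto
    finally show ?thesis by (simp add: fps_sum_nth add.commute)
  qed
  \<comment> \<open>Truncating the rows at size \<open>Suc n\<close> is harmless: by triangularity,
    column \<open>j\<close> uses only entries with \<open>q \<le> j\<close>.\<close>
  have THT: "(P * T\<^sup>T) $$ (i, j)
      = (if i = 0 then 1 else fps_const (G $ i) - fps_shift i G) $ j"
    if "i < Suc n" "j < Suc n" for i j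
  proof -
    have "(P * T\<^sup>T) $$ (i, j)
        = (\<Sum>q<Suc n. P $$ (i, q) * (if q \<le> j then G $ (j - q) else 0))"
      using that P_carrier
      by (simp add: scalar_prod_def lessThan_atLeast0 T_def del: sum.op_ivl_Suc)
    also have "\<dots> = (\<Sum>q\<le>j. P $$ (i, q) * G $ (j - q))"
      using that by (intro sum.mono_neutral_cong_right) auto
    also have "\<dots> = ((\<Sum>p\<le>i. fps_const (G $ (i - p)) * fps_shift p B) * G) $ j"
      using that by (simp add: fps_mult_nth atLeast0AtMost TH)
    finally show ?thesis
      by (simp add: B_def toeplitz_mult_hankel_inverse[OF G_0])
  qed
  \<comment> \<open>For \<open>i > 0\<close> the entry in column 0 is \<open>G $ i - G $ i\<close>.
    Dropping row and column 0 raises both indices by one, hence the offset 2 in \<open>K\<close>;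
    the \<open>n\<close> rows of \<open>-K\<close> give the sign.\<close>
  have "P * T\<^sup>T = four_block_mat (1\<^sub>m 1) (0\<^sub>m 1 n) (0\<^sub>m n 1) ((-1) \<cdot>\<^sub>m K)"
    by (rule eq_matI)
      (use carrier P_carrier in \<open>auto simp: THT K_def add_ac simp del: index_mult_mat(1)\<close>)
  then have "det (P * T\<^sup>T) = (-1) ^ n * det K"
    using carrier by (simp add: det_four_block_mat_lower_left_zero[of _ 1 _ n])
  moreover have "det (P * T\<^sup>T) = det H"
    using carrier P_carrier det_T
    by (simp add: det_mult[of _ "Suc n"] det_transpose[of _ "Suc n"] P_def)
  ultimately show ?thesis by (simp add: H_def K_def B_def)
qed

theorem theorem3:
  fixes c :: "'a::real_normed_field" and k n :: nat
  shows "hankel_d 0 k (n + 1) c = (-1) ^ n * hankel_D (k + 2) k n (\<lambda>_. c)"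
proof -
  define G where "G = A_fps c ^ Suc k"
  have G_0: "G $ 0 = 1"
    by (simp add: G_def A_fps_def fps_power_zeroth)
  \<comment> \<open>The factor \<open>fps_X ^ k\<close> absorbs \<open>k\<close> of the offset
    \<open>k + 2\<close> in \<open>hankel_D\<close>, leaving the 2 required by
    \<open>det_hankel_inverse\<close>.\<close>
  have "a_num (\<lambda>_. c) (m + k) (int k) = G $ m" for m
  proof -
    have "a_num (\<lambda>_. c) (m + k) (int k) = a_fps c k $ (m + k)"
      by (simp add: a_fps_def)
    also have "a_fps c k = fps_X ^ k * G"
      by (subst a_fps_eq_power) (simp add: G_def a_fps_def A_fps_def)
    finally show ?thesis by (simp add: fps_X_power_mult_nth)
  qed
  from this[of "_ + _ + 2"]
  have "hankel_D (k + 2) k n (\<lambda>_. c) = det (mat n n (\<lambda>(i, j). G $ (i + j + 2)))"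
    by (simp add: hankel_D_def add_ac)
  moreover have "b_num c m k = inverse G $ m" for m
    using G_0 by (simp add: b_num_def G_def fps_divide_unit)
  ultimately show ?thesis
    using det_hankel_inverse[OF G_0, of n] by (simp add: hankel_d_def)
qed

end
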